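(* There exists an infinite cubefree binary word $\mathbf{w}$ containing exponentially many distinct squares of length $n$; that is, there is a real constant $c>1$ such that for infinitely many positive integers $n$, the number of distinct factors of $\mathbf{w}$ of length $n$ that are squares is at least $c^n$.
   Context: A square is a non-empty word of the form $xx$; a cube is a non-empty word of the form $xxx$. A (finite or infinite) word is cubefree if none of its factors (contiguous finite subwords) is a cube. A binary word is a word over a two-letter alphabet $\{0,1\}$. *)

theory Defs
  imports Complex_Main "HOL-Library.Omega_Words_Fun"
begin

(* Finite words are lists, infinite (right-infinite) words are functions on nat
   ('a word of HOL-Library.Omega_Words_Fun).  Words over {0,1} are words over bool,
   with 0 rendered as False and 1 as True. *)

definition is_square :: "'a list \<Rightarrow> bool" where
  "is_square y \<longleftrightarrow> (\<exists>x. x \<noteq> [] \<and> y = x @ x)"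

definition is_cube :: "'a list \<Rightarrow> bool" where
  "is_cube y \<longleftrightarrow> (\<exists>x. x \<noteq> [] \<and> y = x @ x @ x)"

(* w [i \<rightarrow> j] is the list of the letters w i, ..., w (j - 1). *)
definition factors_of :: "'a word \<Rightarrow> 'a list set" where
  "factors_of w = {w [i \<rightarrow> j] | i j. i \<le> j}"

definition cubefree :: "'a word \<Rightarrow> bool" where
  "cubefree w \<longleftrightarrow> (\<forall>y \<in> factors_of w. \<not> is_cube y)"

end

theory Submission
  imports Defs "HOL-Library.Discrete_Functions" "HOL-Library.Nat_Bijection"
begin

text \<open>
  The Thue--Morse word is overlap-free, and it contains squares of period \<open>2 ^ Suc k\<close> starting at
  every multiple \<open>2 ^ Suc k * (4 * b + 1)\<close>.  Replace each letter 1 by one fixed binary block of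
  length 9 and each letter 0 by one of two blocks, freely chosen at each occurrence of 0.  The
  blocks are such that the factor 00 occurs in the coded word exactly at the block boundaries.
  Hence a cube of period at least 5 has a period divisible by 9; if that period is not 9 itself,
  decoding yields an overlap in the Thue--Morse word.  The cubes of period at most 4 or equal to 9
  fit into four consecutive blocks and are excluded by a finite check.  So every choice of blocks
  gives a cubefree word, and the choices can be made such that, for every \<open>k\<close>, sufficiently many
  patterns of choices are each written on both halves of some square of period \<open>2 ^ Suc k\<close>.
\<close>

section \<open>The Thue-Morse word and its overlap-freeness\<close>

fun thue_morse :: "nat \<Rightarrow> bool" where
  "thue_morse n = (if n = 0 then False else thue_morse (n div 2) \<noteq> odd n)"

declare thue_morse.simps [simp del]

lemma thue_morse_double: "thue_morse (2 * n) = thue_morse n"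
  by (subst thue_morse.simps) (auto simp: thue_morse.simps[of 0])

lemma thue_morse_Suc_double: "thue_morse (Suc (2 * n)) \<longleftrightarrow> \<not> thue_morse n"
  by (subst thue_morse.simps) auto

text \<open>Two of any three consecutive positions form a pair \<open>2 * b\<close>,
  \<open>2 * b + 1\<close>, and the letters of such a pair differ.\<close>

lemma thue_morse_no_three:
  "\<not> (thue_morse i = thue_morse (Suc i) \<and> thue_morse (Suc i) = thue_morse (Suc (Suc i)))"
proof (cases "even i")
  case True
  then obtain b where "i = 2 * b" by (auto elim: evenE)
  then show ?thesis using thue_morse_double[of b] thue_morse_Suc_double[of b] by auto
next
  case False
  then obtain b where b: "i = Suc (2 * b)" by (auto elim: oddE)
  show ?thesis using thue_morse_double[of "Suc b"] thue_morse_Suc_double[of "Suc b"]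
    by (auto simp: b)
qed

text \<open>
  For odd \<open>p\<close>, the two equalities compare a pair \<open>2 * a, 2 * a + 1\<close>, whose letters always differ,
  with a pair \<open>2 * b + 1, 2 * b + 2\<close>, whose letters differ only if those at \<open>b\<close> and \<open>b + 1\<close> agree.
\<close>
lemma thue_morse_shift_pair:
  assumes "odd p" "thue_morse j = thue_morse (j + p)" "thue_morse (Suc j) = thue_morse (Suc j + p)"
  shows "thue_morse ((if even j then j + p else j) div 2)
       = thue_morse (Suc ((if even j then j + p else j) div 2))"
proof (cases "even j")
  case True
  obtain a where a: "j = 2 * a" using True by (auto elim: evenE)
  obtain b where b: "j + p = Suc (2 * b)" using True \<open>odd p\<close> by (metis odd_add oddE Suc_eq_plus1)
  have 1: "thue_morse (Suc j) \<longleftrightarrow> \<not> thue_morse j"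
    using thue_morse_double[of a] thue_morse_Suc_double[of a] a by simp
  have 2: "thue_morse (j + p) \<longleftrightarrow> \<not> thue_morse b" using b thue_morse_Suc_double by simp
  have "Suc j + p = 2 * Suc b" using b by simp
  hence 3: "thue_morse (Suc j + p) = thue_morse (Suc b)" by (metis thue_morse_double)
  show ?thesis using 1 2 3 assms(2,3) True b by auto
next
  case False
  obtain a where a: "j + p = 2 * a" using False \<open>odd p\<close> by (metis odd_add evenE)
  obtain b where b: "j = Suc (2 * b)" using False by (auto elim: oddE)
  have "Suc j + p = Suc (2 * a)" using a by simp
  hence 1: "thue_morse (Suc j + p) \<longleftrightarrow> \<not> thue_morse (j + p)"
    using thue_morse_double[of a] thue_morse_Suc_double[of a] a by simp
  have 2: "thue_morse j \<longleftrightarrow> \<not> thue_morse b" using b thue_morse_Suc_double by simp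
  have "Suc j = 2 * Suc b" using b by simp
  hence 3: "thue_morse (Suc j) = thue_morse (Suc b)" by (metis thue_morse_double)
  show ?thesis using 1 2 3 assms(2,3) False b by auto
qed

text \<open>Strong induction on \<open>p\<close>. For even \<open>p\<close>, every second position
  of a supposed overlap gives an overlap of period \<open>p div 2\<close>; for odd \<open>p\<close>
  there would be three equal consecutive letters.\<close>

lemma thue_morse_overlap_free:
  assumes "p > 0"
  shows "\<exists>j\<le>p. thue_morse (i + j) \<noteq> thue_morse (i + j + p)"
  using assms
proof (induction p arbitrary: i rule: less_induct)
  case (less p)
  show ?case
  proof (rule ccontr)
    assume "\<not> ?case"
    hence per: "thue_morse (i + j) = thue_morse (i + j + p)" if "j \<le> p" for j
      using that by blast
    show False
    proof (cases "even p")
      case True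
      then obtain q where q: "p = 2 * q" by (auto elim: evenE)
      have "thue_morse (i div 2 + j) = thue_morse (i div 2 + j + q)" if "j \<le> q" for j
      proof (cases "even i")
        case True
        hence "i + 2 * j = 2 * (i div 2 + j)" "i + 2 * j + p = 2 * (i div 2 + j + q)"
          using q by auto
        thus ?thesis using per[of "2 * j"] that q by (metis mult_le_mono2 thue_morse_double)
      next
        case False
        hence "i + 2 * j = Suc (2 * (i div 2 + j))" "i + 2 * j + p = Suc (2 * (i div 2 + j + q))"
          using q by (auto simp: algebra_simps odd_two_times_div_two_succ)
        thus ?thesis using per[of "2 * j"] that q by (metis mult_le_mono2 thue_morse_Suc_double)
      qed
      moreover have "q < p" "q > 0" using q less.prems by auto
      ultimately show False using less.IH[of q "i div 2"] by blast
    next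
      case False
      show False
      proof (cases "p = 1")
        case True
        show False using per[of 0] per[of 1] thue_morse_no_three[of i] True by auto
      next
        case p1: False
        \<comment> \<open>This makes the offsets 0 to 3 available: 0 and 1 give equal letters at
          \<open>b\<close> and \<open>b + 1\<close>, while 2 and 3 give them at \<open>b + 1\<close>
          and \<open>b + 2\<close>.\<close>
        have p3: "p \<ge> 3" using p1 False less.prems
          by (metis One_nat_def Suc_1 Suc_leI even_numeral le_neq_implies_less numeral_3_eq_3)
        define b where "b = (if even i then i + p else i) div 2"
        have "thue_morse b = thue_morse (Suc b)"
          using thue_morse_shift_pair[OF False, of i] per[of 0] per[of 1] p3 by (auto simp: b_def)
        moreover have "(if even (i + 2) then i + 2 + p else i + 2) div 2 = Suc b"
          by (auto simp: b_def)
        hence "thue_morse (Suc b) = thue_morse (Suc (Suc b))"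
          using thue_morse_shift_pair[OF False, of "i + 2"] per[of 2] per[of 3] p3
          by (simp add: eval_nat_numeral)
        ultimately show False using thue_morse_no_three[of b] by auto
      qed
    qed
  qed
qed

text \<open>\<open>thue_morse n\<close> is the parity of the binary digit sum of \<open>n\<close>,
  and \<open>2 ^ k * a + r\<close> has the digits of \<open>a\<close> followed by those of
  \<open>r\<close>.\<close>

lemma thue_morse_block:
  "r < 2 ^ k \<Longrightarrow> thue_morse (2 ^ k * a + r) \<longleftrightarrow> thue_morse a \<noteq> thue_morse r"
proof (induction k arbitrary: r)
  case 0
  then show ?case by (simp add: thue_morse.simps[of 0])
next
  case (Suc k)
  have r2: "r div 2 < 2 ^ k" using Suc.prems by auto
  show ?case
  proof (cases "even r")
    case True
    then obtain s where s: "r = 2 * s" by (auto elim: evenE)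
    have "2 ^ Suc k * a + r = 2 * (2 ^ k * a + s)" using s by simp
    moreover have "s < 2 ^ k" using r2 s by simp
    ultimately show ?thesis using Suc.IH[of s] s thue_morse_double by metis
  next
    case False
    then obtain s where s: "r = Suc (2 * s)" by (auto elim: oddE)
    have "2 ^ Suc k * a + r = Suc (2 * (2 ^ k * a + s))" using s by simp
    moreover have "s < 2 ^ k" using r2 s by simp
    ultimately show ?thesis using Suc.IH[of s] s thue_morse_Suc_double by metis
  qed
qed

section \<open>The coding by blocks of length 9 and its cubefreeness\<close>

fun code_block :: "bool \<Rightarrow> bool \<Rightarrow> bool list" where
  "code_block False False = [False, False, True, False, True, True, False, True, True]"
| "code_block False True = [False, False, True, True, False, True, False, True, True]"
| "code_block True _ = [False, False, True, True, False, True, True, False, True]"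

definition coded :: "(nat \<Rightarrow> bool) \<Rightarrow> bool word" where
  "coded d n = code_block (thue_morse (n div 9)) (d (n div 9)) ! (n mod 9)"

lemma length_code_block [simp]: "length (code_block a b) = 9"
  by (cases "(a, b)" rule: code_block.cases) auto

text \<open>A cube of period at most 9 that starts in the first block ends within four blocks, as 8
  + 27 < 36. Three equal blocks would be a cube of period 9, hence the premise on the
  letters.\<close>

lemma code_block_short_periods:
  "\<forall>a0 a1 a2 a3 b0 b1 b2 b3. \<not> (a0 = a1 \<and> a1 = a2) \<and> \<not> (a1 = a2 \<and> a2 = a3) \<longrightarrow>
    (let v = code_block a0 b0 @ code_block a1 b1 @ code_block a2 b2 @ code_block a3 b3
     in list_all (\<lambda>p. list_all (\<lambda>r. list_ex (\<lambda>j. v ! (r + j) \<noteq> v ! (r + j + p)) [0..<2 * p])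
          [0..<9]) [1, 2, 3, 4, 9])"
  by code_simp

text \<open>Every block starts with 001, ends in 1 and contains no second 00.\<close>

lemma coded_double_zero_iff:
  "\<not> coded d n \<and> \<not> coded d (Suc n) \<longleftrightarrow> 9 dvd n"
proof -
  define q r where "q = n div 9" "r = n mod 9"
  have n: "n = 9 * q + r" "r < 9" by (simp_all add: q_r_def)
  obtain a b where ab: "thue_morse q = a" "d q = b" by blast
  have "r \<in> {0, 1, 2, 3, 4, 5, 6, 7, 8}" using n(2) by auto
  hence "\<not> coded d (9 * q + r) \<and> \<not> coded d (Suc (9 * q + r)) \<longleftrightarrow> r = 0"
    using ab
    by (cases "(a, b)" rule: code_block.cases;
        cases "(thue_morse (Suc q), d (Suc q))" rule: code_block.cases)
       (auto simp: coded_def div_Suc mod_Suc)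
  moreover have "r = 0 \<longleftrightarrow> 9 dvd n" by (auto simp: q_r_def)
  ultimately show ?thesis using n(1) by simp
qed

text \<open>The 00 at the first block boundary from \<open>i\<close> on recurs \<open>p\<close>
  letters later, hence at a boundary again. It lies within the first 10 letters, which
  \<open>p \<ge> 5\<close> keeps inside the range of \<open>per\<close>.\<close>

lemma coded_period_multiple:
  assumes per: "\<forall>j<2 * p. coded d (i + j) = coded d (i + j + p)" and "p \<ge> 5"
  shows "9 dvd p"
proof -
  define m where "m = 9 * ((i + 8) div 9) - i"
  have "i \<le> 9 * ((i + 8) div 9)" by linarith
  hence "i + m = 9 * ((i + 8) div 9)" by (simp add: m_def)
  hence "9 dvd i + m" by simp
  moreover have "m \<le> 8" unfolding m_def by linarith
  hence "coded d (i + m) = coded d (i + m + p)" "coded d (Suc (i + m)) = coded d (Suc (i + m + p))"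
    using per[rule_format, of m] per[rule_format, of "Suc m"] \<open>p \<ge> 5\<close> by auto
  ultimately have "9 dvd i + m + p" using coded_double_zero_iff by metis
  with \<open>9 dvd i + m\<close> show ?thesis by (metis dvd_add_right_iff)
qed

text \<open>The blocks of 0 differ from that of 1 at indices 6 and 7, and from each other at 3 and
  4.\<close>

lemma code_block_determines:
  assumes "\<And>s. s < 9 \<Longrightarrow> code_block a b ! s = code_block a' b' ! s"
  shows "a = a'" and "\<not> a \<Longrightarrow> b = b'"
  using assms[of 3] assms[of 4] assms[of 5] assms[of 6] assms[of 7]
  by (cases "(a, b)" rule: code_block.cases; cases "(a', b')" rule: code_block.cases; simp)+

lemma coded_block_nth: "s < 9 \<Longrightarrow> coded d (9 * q + s) = code_block (thue_morse q) (d q) ! s"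
  by (simp add: coded_def)

lemma coded_no_long_period:
  assumes per: "\<forall>j<2 * p. coded d (i + j) = coded d (i + j + p)" and p: "p = 9 * q" "q \<ge> 2"
  shows False
proof -
  define t where "t = (i + 8) div 9"
  have t: "i \<le> 9 * t" "9 * t \<le> i + 8" by (auto simp: t_def)
  have "thue_morse (t + k) = thue_morse (t + k + q)" if "k \<le> q" for k
  proof (rule code_block_determines(1))
    fix s :: nat assume s: "s < 9"
    define j where "j = 9 * (t + k) + s - i"
    have ij: "i + j = 9 * (t + k) + s" using t by (simp add: j_def)
    have "j \<le> 9 * k + 16" using ij t(2) s by simp
    \<comment> \<open>\<open>9 * q + 16 < 18 * q\<close> holds from \<open>q = 2\<close> on; period
      9 is left to the finite check.\<close>
    also have "\<dots> < 2 * p" using that p by simp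
    finally have "j < 2 * p" .
    moreover have "i + j + p = 9 * (t + k + q) + s" using ij p by simp
    ultimately have "coded d (9 * (t + k) + s) = coded d (9 * (t + k + q) + s)"
      using per ij by metis
    thus "code_block (thue_morse (t + k)) (d (t + k)) ! s
        = code_block (thue_morse (t + k + q)) (d (t + k + q)) ! s"
      using s by (simp only: coded_block_nth)
  qed
  thus False using thue_morse_overlap_free[of q t] p by force
qed

lemma coded_four_blocks:
  assumes "x < 36"
  shows "coded d (9 * t + x) =
    (code_block (thue_morse t) (d t) @ code_block (thue_morse (t + 1)) (d (t + 1)) @
     code_block (thue_morse (t + 2)) (d (t + 2)) @ code_block (thue_morse (t + 3)) (d (t + 3))) ! x"
proof -
  define q s where "q = x div 9" "s = x mod 9"
  have x: "x = 9 * q + s" "s < 9" by (simp_all add: q_s_def)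
  hence eq: "coded d (9 * t + x) = code_block (thue_morse (t + q)) (d (t + q)) ! s"
    using coded_block_nth[of s d "t + q"] by (simp add: algebra_simps)
  have "q < 4" using x assms by linarith
  then consider "q = 0" | "q = 1" | "q = 2" | "q = 3" by linarith
  thus ?thesis by cases (use eq x in \<open>simp_all add: nth_append\<close>)
qed

lemma coded_no_short_period:
  assumes per: "\<forall>j<2 * p. coded d (i + j) = coded d (i + j + p)" and p: "p \<in> {1, 2, 3, 4, 9}"
  shows False
proof -
  define t r where "t = i div 9" "r = i mod 9"
  have i: "i = 9 * t + r" "r < 9" by (simp_all add: t_r_def)
  define v where "v = code_block (thue_morse t) (d t) @ code_block (thue_morse (t + 1)) (d (t + 1)) @
     code_block (thue_morse (t + 2)) (d (t + 2)) @ code_block (thue_morse (t + 3)) (d (t + 3))"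
  have no_three: "\<not> (thue_morse t = thue_morse (t + 1) \<and> thue_morse (t + 1) = thue_morse (t + 2)) \<and>
      \<not> (thue_morse (t + 1) = thue_morse (t + 2) \<and> thue_morse (t + 2) = thue_morse (t + 3))"
    using thue_morse_no_three[of t] thue_morse_no_three[of "t + 1"] by (simp add: numeral_eq_Suc)
  have "list_all (\<lambda>p. list_all (\<lambda>r. list_ex (\<lambda>j. v ! (r + j) \<noteq> v ! (r + j + p)) [0..<2 * p])
          [0..<9]) [1, 2, 3, 4, 9]"
    unfolding v_def by (rule code_block_short_periods[rule_format, unfolded Let_def, OF no_three])
  moreover have "p \<in> set [1, 2, 3, 4, 9]" "r \<in> set [0..<9]" using p i(2) by simp_all
  ultimately have "list_ex (\<lambda>j. v ! (r + j) \<noteq> v ! (r + j + p)) [0..<2 * p]"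
    unfolding list_all_iff by blast
  then obtain j where j: "j < 2 * p" "v ! (r + j) \<noteq> v ! (r + j + p)"
    unfolding list_ex_iff set_upt by (meson atLeastLessThan_iff)
  have "r + j + p < 36" using j(1) i(2) p by auto
  hence "coded d (9 * t + (r + j)) = v ! (r + j)" "coded d (9 * t + (r + j + p)) = v ! (r + j + p)"
    unfolding v_def by (simp_all only: coded_four_blocks)
  thus False using per j i by (simp add: add.assoc)
qed

lemma cubefree_iff_no_period:
  "cubefree w \<longleftrightarrow> (\<forall>p>0. \<forall>i. \<exists>j<2 * p. w (i + j) \<noteq> w (i + j + p))"
proof (intro iffI allI impI)
  fix p i :: nat
  assume "cubefree w" "p > 0"
  show "\<exists>j<2 * p. w (i + j) \<noteq> w (i + j + p)"
  proof (rule ccontr)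
    assume "\<not> ?thesis"
    hence per: "w (i + j) = w (i + j + p)" if "j < 2 * p" for j using that by blast
    define x where "x = w [i \<rightarrow> i + p]"
    have "w [i \<rightarrow> i + 3 * p] = x @ x @ x"
    proof (rule nth_equalityI)
      fix k assume "k < length (w [i \<rightarrow> i + 3 * p])"
      hence k: "k < 3 * p" by simp
      consider "k < p" | "p \<le> k" "k < 2 * p" | "2 * p \<le> k" by linarith
      thus "w [i \<rightarrow> i + 3 * p] ! k = (x @ x @ x) ! k"
        using k per[of "k - p"] per[of "k - p - p"] by cases (auto simp: x_def nth_append)
    qed (simp add: x_def)
    moreover have "x \<noteq> []" using \<open>p > 0\<close> by (simp add: x_def)
    ultimately show False using \<open>cubefree w\<close>
      unfolding cubefree_def factors_of_def is_cube_def by (metis (mono_tags, lifting) le_add1 mem_Collect_eq)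
  qed
next
  assume free: "\<forall>p>0. \<forall>i. \<exists>j<2 * p. w (i + j) \<noteq> w (i + j + p)"
  show "cubefree w" unfolding cubefree_def
  proof (intro ballI notI)
    fix y assume "y \<in> factors_of w" "is_cube y"
    then obtain i l where y: "y = w [i \<rightarrow> l]" by (auto simp: factors_of_def)
    then obtain x where x: "w [i \<rightarrow> l] = x @ x @ x" "x \<noteq> []"
      using \<open>is_cube y\<close> by (auto simp: is_cube_def)
    define p where "p = length x"
    have "l - i = 3 * p" using arg_cong[OF x(1), of length] by (simp add: p_def)
    hence nth: "w (i + k) = (x @ x @ x) ! k" if "k < 3 * p" for k
      using that subsequence_nth[of k l i w] x by simp
    have "w (i + j) = w (i + j + p)" if "j < 2 * p" for j
      using nth[of j] nth[of "j + p"] that by (auto simp: nth_append p_def add.assoc)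
    moreover have "p > 0" using x by (simp add: p_def)
    ultimately show False using free by blast
  qed
qed

lemma cubefree_coded: "cubefree (coded d)"
  unfolding cubefree_iff_no_period
proof (intro allI impI, rule ccontr)
  fix p i :: nat
  assume "p > 0" and "\<not> (\<exists>j<2 * p. coded d (i + j) \<noteq> coded d (i + j + p))"
  hence per: "\<forall>j<2 * p. coded d (i + j) = coded d (i + j + p)" by blast
  show False
  proof (cases "p < 5 \<or> p = 9")
    case True
    hence "p \<in> {1, 2, 3, 4, 9}" using \<open>p > 0\<close> by auto
    thus False using coded_no_short_period[OF per] by blast
  next
    case False
    then obtain q where "p = 9 * q" using coded_period_multiple[OF per] by auto
    moreover from this have "q \<ge> 2" using False by (cases q) auto
    ultimately show False using coded_no_long_period[OF per] by blast
  qed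
qed

section \<open>Marked squares and their number\<close>

text \<open>
  A position \<open>n\<close> in \<open>{2 ^ K..<2 ^ Suc K}\<close> with \<open>K = prod_encode (k, set_encode P) + 3\<close> is
  marked according to \<open>P\<close>, so every pair of a scale \<open>k\<close> and a finite pattern \<open>P\<close> has a dyadic range
  of its own.  An element \<open>a\<close> of \<open>P\<close> marks both offsets \<open>2 * a\<close> and \<open>2 * a + 1\<close>, because exactly
  one of them carries the Thue--Morse letter 0, where the mark is visible.  The summand 3 makes the
  range long enough for the square at \<open>marked_start k P\<close>.
\<close>
definition marking :: "nat \<Rightarrow> bool" where
  "marking n = (let (k, m) = prod_decode (floor_log n - 3)
    in n mod 2 ^ Suc k div 2 \<in> set_decode m)"

definition marked_start :: "nat \<Rightarrow> nat set \<Rightarrow> nat" where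
  "marked_start k P = 2 ^ (prod_encode (k, set_encode P) + 3) + 2 ^ Suc k"

lemma marked_start_eq:
  obtains e where "marked_start k P = 2 ^ Suc k * (4 * 2 ^ e + 1)"
proof -
  obtain e where e: "prod_encode (k, set_encode P) = k + e"
    using le_prod_encode_1 le_Suc_ex by blast
  have "marked_start k P = 2 ^ Suc k * (4 * 2 ^ e + 1)"
    by (simp add: marked_start_def e power_add algebra_simps)
  thus ?thesis by (rule that)
qed

lemma marking_marked_start:
  assumes "finite P" "r < 2 * 2 ^ Suc k"
  shows "marking (marked_start k P + r) \<longleftrightarrow> r mod 2 ^ Suc k div 2 \<in> P"
proof -
  define K where "K = prod_encode (k, set_encode P) + 3"
  define n where "n = marked_start k P + r"
  have "k + 3 \<le> K" using le_prod_encode_1 by (simp add: K_def)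
  \<comment> \<open>The offset from \<open>2 ^ K\<close> stays below \<open>3 * 2 ^ Suc k\<close>,
    hence below \<open>2 ^ (k + 3)\<close>, so \<open>n\<close> does not leave the dyadic
    range.\<close>
  hence le: "(2::nat) ^ (k + 3) \<le> 2 ^ K" by (intro power_increasing) auto
  have n: "n = 2 ^ K + 2 ^ Suc k + r" by (simp add: n_def marked_start_def K_def)
  have "floor_log n = K"
  proof (rule floor_log_eqI)
    show "n < 2 * 2 ^ K" using n le assms(2) by (simp add: power_add)
  qed (simp_all add: n)
  moreover have "n mod 2 ^ Suc k = r mod 2 ^ Suc k"
  proof -
    obtain e where "marked_start k P = 2 ^ Suc k * (4 * 2 ^ e + 1)" by (rule marked_start_eq)
    thus ?thesis by (simp only: n_def mod_mult_self4)
  qed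
  ultimately show ?thesis using assms(1)
    by (simp add: marking_def n_def[symmetric] K_def)
qed

lemma thue_morse_power_two: "thue_morse (2 ^ e)"
  using thue_morse_Suc_double[of 0]
  by (induction e) (simp_all add: thue_morse_double thue_morse.simps[of 0])

text \<open>As \<open>2 ^ e\<close> carries the letter 1, both \<open>4 * 2 ^ e + 1\<close> and
  \<open>4 * 2 ^ e + 2\<close> carry 0. By \<open>thue_morse_block\<close>, both halves of the range
  copy the prefix of length \<open>2 ^ Suc k\<close>.\<close>

lemma thue_morse_marked_start:
  assumes "r < 2 * 2 ^ Suc k"
  shows "thue_morse (marked_start k P + r) = thue_morse (r mod 2 ^ Suc k)"
proof -
  obtain e where e: "marked_start k P = 2 ^ Suc k * (4 * 2 ^ e + 1)" by (rule marked_start_eq)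
  have "\<not> thue_morse (4 * 2 ^ e + 1)"
    using thue_morse_Suc_double[of "2 * 2 ^ e"] thue_morse_double[of "2 ^ e"] thue_morse_power_two[of e]
    by simp
  moreover have "\<not> thue_morse (4 * 2 ^ e + 2)"
    using thue_morse_double[of "Suc (2 * 2 ^ e)"] thue_morse_Suc_double[of "2 ^ e"] thue_morse_power_two[of e]
    by simp
  moreover have "r < 2 ^ Suc k \<or> r - 2 ^ Suc k < 2 ^ Suc k \<and>
      marked_start k P + r = 2 ^ Suc k * (4 * 2 ^ e + 2) + (r - 2 ^ Suc k)"
    using assms by (auto simp: e algebra_simps)
  ultimately show ?thesis
    using thue_morse_block[of r "Suc k" "4 * 2 ^ e + 1"]
      thue_morse_block[of "r - 2 ^ Suc k" "Suc k" "4 * 2 ^ e + 2"] e assms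
    by (metis mod_less mod_if not_less)
qed

text \<open>Letter and mark both depend on the block index only modulo \<open>2 ^ Suc k\<close>;
  this is what makes the two halves of \<open>marked_square\<close> equal.\<close>

lemma coded_marked_start:
  assumes "finite P" "x < 18 * 2 ^ Suc k"
  shows "coded marking (9 * marked_start k P + x) =
    code_block (thue_morse (x div 9 mod 2 ^ Suc k)) (x div 9 mod 2 ^ Suc k div 2 \<in> P) ! (x mod 9)"
proof -
  have r: "x div 9 < 2 * 2 ^ Suc k" using assms(2) by (simp add: less_mult_imp_div_less)
  have "9 * marked_start k P + x = 9 * (marked_start k P + x div 9) + x mod 9" by simp
  thus ?thesis
    using coded_block_nth[of "x mod 9" marking "marked_start k P + x div 9"]
    by (simp only: thue_morse_marked_start[OF r] marking_marked_start[OF assms(1) r]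
        mod_less_divisor zero_less_numeral)
qed

definition marked_square :: "nat \<Rightarrow> nat set \<Rightarrow> bool list" where
  "marked_square k P =
    coded marking [9 * marked_start k P \<rightarrow> 9 * marked_start k P + 18 * 2 ^ Suc k]"

lemma marked_square_in_factors: "marked_square k P \<in> factors_of (coded marking)"
  unfolding marked_square_def factors_of_def by fastforce

lemma length_marked_square: "length (marked_square k P) = 18 * 2 ^ Suc k"
  by (simp add: marked_square_def)

lemma marked_square_nth:
  assumes "finite P" "x < 18 * 2 ^ Suc k"
  shows "marked_square k P ! x =
    code_block (thue_morse (x div 9 mod 2 ^ Suc k)) (x div 9 mod 2 ^ Suc k div 2 \<in> P) ! (x mod 9)"
  using assms coded_marked_start[OF assms] by (simp add: marked_square_def)

lemma is_square_marked_square: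
  assumes "finite P"
  shows "is_square (marked_square k P)"
proof -
  define l :: nat where "l = 9 * 2 ^ Suc k"
  have len: "length (marked_square k P) = 2 * l" by (simp add: length_marked_square l_def)
  have "drop l (marked_square k P) = take l (marked_square k P)"
  proof (rule nth_equalityI)
    fix x assume "x < length (drop l (marked_square k P))"
    hence x: "x < l" by (simp add: len)
    have "(l + x) div 9 = 2 ^ Suc k + x div 9" by (simp add: l_def)
    moreover have "(l + x) mod 9 = x mod 9" unfolding l_def by (rule mod_mult_self4)
    ultimately have "marked_square k P ! (l + x) = marked_square k P ! x"
      using marked_square_nth[OF assms, of "l + x" k] marked_square_nth[OF assms, of x k] x
      by (simp add: l_def)
    thus "drop l (marked_square k P) ! x = take l (marked_square k P) ! x"
      using x len by simp
  qed (simp add: len)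
  moreover have "take l (marked_square k P) \<noteq> []" using len by (auto simp: l_def)
  ultimately show ?thesis unfolding is_square_def by (metis append_take_drop_id)
qed

text \<open>Membership of \<open>a\<close> in the pattern is read off from the block of whichever of
  \<open>2 * a\<close> and \<open>2 * a + 1\<close> carries the letter 0.\<close>

lemma inj_on_marked_square: "inj_on (marked_square k) (Pow {..<2 ^ k})"
proof (rule inj_onI)
  fix P Q :: "nat set"
  assume PQ: "P \<in> Pow {..<2 ^ k}" "Q \<in> Pow {..<2 ^ k}" and eq: "marked_square k P = marked_square k Q"
  hence fin: "finite P" "finite Q" using finite_subset by blast+
  have "a \<in> P \<longleftrightarrow> a \<in> Q" if a: "a < 2 ^ k" for a
  proof -
    obtain r where r: "r div 2 = a" "\<not> thue_morse r"
    proof (cases "thue_morse a")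
      case True
      thus ?thesis using that[of "Suc (2 * a)"] thue_morse_Suc_double by simp
    next
      case False
      thus ?thesis using that[of "2 * a"] thue_morse_double by simp
    qed
    have rk: "r < 2 ^ Suc k" using r(1) a by auto
    have "code_block (thue_morse r) (a \<in> P) ! s = code_block (thue_morse r) (a \<in> Q) ! s"
      if s: "s < 9" for s
    proof -
      have "9 * r + s < 18 * 2 ^ Suc k" using rk s by simp
      thus ?thesis
        using eq marked_square_nth[OF fin(1), of "9 * r + s" k] marked_square_nth[OF fin(2), of "9 * r + s" k]
          rk s r(1) by simp
    qed
    thus ?thesis using code_block_determines(2)[OF _ r(2)] by blast
  qed
  thus "P = Q" using PQ by blast
qed

lemma card_squares_coded_marking:
  "card {y \<in> factors_of (coded marking). length y = 36 * 2 ^ k \<and> is_square y} \<ge> 2 ^ 2 ^ k"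
proof -
  let ?S = "{y \<in> factors_of (coded marking). length y = 36 * 2 ^ k \<and> is_square y}"
  have "marked_square k ` Pow {..<2 ^ k} \<subseteq> ?S"
    using marked_square_in_factors length_marked_square is_square_marked_square
    by (auto simp: finite_subset)
  \<comment> \<open>\<open>card\<close> of an infinite set would be 0; here the words have a fixed
    length over a finite alphabet.\<close>
  moreover have "finite ?S"
    by (rule finite_subset[OF _ finite_lists_length_eq[OF finite[of "UNIV :: bool set"]]]) auto
  ultimately have "card (marked_square k ` Pow {..<2 ^ k}) \<le> card ?S" by (rule card_mono[rotated])
  thus ?thesis by (simp add: card_image[OF inj_on_marked_square] card_Pow)
qed

theorem theorem2:
  shows "\<exists>w :: bool word. cubefree w \<and>
    (\<exists>c :: real. c > 1 \<and>
      infinite {n :: nat. n > 0 \<and>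
        real (card {y \<in> factors_of w. length y = n \<and> is_square y}) \<ge> c ^ n})"
proof (intro exI conjI)
  \<comment> \<open>Length \<open>36 * 2 ^ k\<close> comes with \<open>2 ^ 2 ^ k\<close> squares, so
    the 36th root of 2 gives exactly this bound.\<close>
  define c :: real where "c = 2 powr (1 / 36)"
  let ?N = "{n :: nat. n > 0 \<and>
      real (card {y \<in> factors_of (coded marking). length y = n \<and> is_square y}) \<ge> c ^ n}"
  show "c > 1" by (simp add: c_def)
  have "c ^ (36 * 2 ^ k) = 2 ^ 2 ^ k" for k
  proof -
    have "c ^ 36 = 2" by (simp add: c_def powr_power)
    thus ?thesis by (simp add: power_mult)
  qed
  moreover have "real (2 ^ 2 ^ k) \<le>
      real (card {y \<in> factors_of (coded marking). length y = 36 * 2 ^ k \<and> is_square y})" for k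
    using card_squares_coded_marking by (simp only: of_nat_le_iff)
  ultimately have "range (\<lambda>k. 36 * 2 ^ k) \<subseteq> ?N" by auto
  moreover have "inj (\<lambda>k. 36 * 2 ^ k :: nat)" by (auto intro: injI)
  hence "infinite (range (\<lambda>k. 36 * 2 ^ k :: nat))" by (rule range_inj_infinite)
  ultimately show "infinite ?N" by (rule infinite_super)
qed (rule cubefree_coded)

end
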